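(* Let $n,d$ be positive integers, let $N=\binom{n+d}{d}-1$, and let $h:\mathbb{N}\to\mathbb{N}$ be the Hilbert function of a projective variety in $\mathbb{P}^N$. Then there exists a projective variety $\mathbb{X}\subseteq V_{n,d}\subseteq\mathbb{P}^N$ such that $H_{\mathbb{X}}(t)=h(t)$ for all $t$ if and only if there exists $k:\mathbb{N}\to\mathbb{N}$, the Hilbert function of a projective variety in $\mathbb{P}^n$, such that $h(t)=k(dt)$ for all $t\in\mathbb{N}$.
   Context: $\mathbb{K}$ is an algebraically closed field of characteristic $0$, and projective spaces are over $\mathbb{K}$; $\mathbb{N}$ includes $0$. A projective variety means a reduced closed subscheme of projective space (not necessarily irreducible), and its Hilbert function $H_{\mathbb{X}}(t)$ is the Hilbert function of its homogeneous coordinate ring (polynomial ring modulo the radical homogeneous ideal of $\mathbb{X}$). The Veronese variety $V_{n,d}\subseteq\mathbb{P}^N$ is the image of the map $\nu_{n,d}:\mathbb{P}^n\to\mathbb{P}^N$ sending $[x_0,\dots,x_n]$ to the point whose coordinates are all monomials of degree $d$ in $x_0,\dots,x_n$. *)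

theory Defs
  imports "HOL-Library.Poly_Mapping" "HOL-Algebra.Algebra" "HOL-Algebra.Algebraic_Closure_Type"
begin

text \<open>
  Projective $n$-space over \<open>'k\<close> has homogeneous coordinates indexed by \<open>{..n}\<close>.  A monomial is
  an exponent vector of type \<open>nat \<Rightarrow>\<^sub>0 nat\<close>, and a polynomial is a finitely supported
  function from monomials to coefficients; the multiplication of \<open>Poly_Mapping\<close> is the usual one.
\<close>

type_synonym 'k mpoly = "(nat \<Rightarrow>\<^sub>0 nat) \<Rightarrow>\<^sub>0 'k"

definition mon_degree :: "(nat \<Rightarrow>\<^sub>0 nat) \<Rightarrow> nat"
  where "mon_degree m = (\<Sum>i\<in>Poly_Mapping.keys m. Poly_Mapping.lookup m i)"

definition monomials :: "nat \<Rightarrow> nat \<Rightarrow> (nat \<Rightarrow>\<^sub>0 nat) set"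
  where "monomials n d = {m. Poly_Mapping.keys m \<subseteq> {..n} \<and> mon_degree m = d}"

lemma ex_monomial_enumeration:
  "\<exists>e. bij_betw e {..((n + d) choose d) - 1} (monomials n d)"
proof -
  let ?L = "{l::nat list. length l = n+1 \<and> sum_list l = d}"
  have c: "card ?L = (n+d) choose d" using card_length_sum_list[of "n+1" d] by (simp add: add.commute)
  have f: "finite ?L" by (rule card_ge_0_finite) (simp only: c, simp)
  have "bij_betw (\<lambda>m. map (Poly_Mapping.lookup m) [0..<n+1]) (monomials n d) ?L"
  proof (rule bij_betwI[where g="Poly_Mapping.nth"])
    have dg: "mon_degree m = sum (Poly_Mapping.lookup m) {..<Suc n}" if "Poly_Mapping.keys m \<subseteq> {..n}" for m
      unfolding mon_degree_def by (rule sum.mono_neutral_left) (use that in \<open>auto simp: in_keys_iff\<close>)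
    show "(\<lambda>m. map (Poly_Mapping.lookup m) [0..<n+1]) \<in> monomials n d \<rightarrow> ?L"
      using dg by (auto simp: monomials_def sum_list_sum_nth atLeast0LessThan simp del: sum.lessThan_Suc upt_Suc intro!: sum.cong)
    show "Poly_Mapping.nth \<in> ?L \<rightarrow> monomials n d"
    proof safe
      fix l :: "nat list" assume l: "length l = n+1" "d = sum_list l"
      have k: "Poly_Mapping.keys (Poly_Mapping.nth l) \<subseteq> {..n}" using l
        by (auto simp: in_keys_iff nth.rep_eq nth_default_def simp del: keys_nth split: if_splits)
      show "Poly_Mapping.nth l \<in> monomials n (sum_list l)"
        using k dg[OF k] l by (auto simp: monomials_def sum_list_sum_nth atLeast0LessThan nth.rep_eq nth_default_def simp del: sum.lessThan_Suc intro!: sum.cong)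
    qed
    show "Poly_Mapping.nth (map (Poly_Mapping.lookup x) [0..<n+1]) = x" if "x \<in> monomials n d" for x
    proof (rule poly_mapping_eqI)
      fix i
      have "Poly_Mapping.lookup x i = 0" if "\<not> i < n + 1"
        using \<open>x \<in> monomials n d\<close> that by (auto simp: monomials_def in_keys_iff subset_iff)
      then show "Poly_Mapping.lookup (Poly_Mapping.nth (map (Poly_Mapping.lookup x) [0..<n+1])) i =
          Poly_Mapping.lookup x i"
        by (cases "i < n + 1") (simp_all add: nth.rep_eq nth_default_def del: upt_Suc)
    qed
    show "map (Poly_Mapping.lookup (Poly_Mapping.nth y)) [0..<n+1] = y" if "y \<in> ?L" for y
      using that by (auto intro!: nth_equalityI simp: nth.rep_eq nth_default_def simp del: upt_Suc)
  qed
  then have "card (monomials n d) = (n+d) choose d" "finite (monomials n d)"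
    using c f by (simp_all add: bij_betw_same_card bij_betw_finite)
  moreover have "Suc (((n + d) choose d) - 1) = (n + d) choose d"
    by (metis Suc_diff_1 zero_less_binomial le_add2)
  ultimately have "card {..((n + d) choose d) - 1} = card (monomials n d)" "finite (monomials n d)"
    by (simp_all only: card_atMost)
  then show ?thesis by (intro finite_same_card_bij finite_atMost)
qed

definition eval_mon :: "(nat \<Rightarrow> 'k) \<Rightarrow> (nat \<Rightarrow>\<^sub>0 nat) \<Rightarrow> 'k::comm_ring_1"
  where "eval_mon v m = (\<Prod>i\<in>Poly_Mapping.keys m. v i ^ Poly_Mapping.lookup m i)"

definition eval_poly :: "(nat \<Rightarrow> 'k) \<Rightarrow> 'k mpoly \<Rightarrow> 'k::comm_ring_1"
  where "eval_poly v p = (\<Sum>m\<in>Poly_Mapping.keys p. Poly_Mapping.lookup p m * eval_mon v m)"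

definition coord_poly_ring :: "nat \<Rightarrow> 'k::field mpoly ring"
  where "coord_poly_ring n = ring_of_type_algebra
    \<lparr>carrier := {p. \<forall>m\<in>Poly_Mapping.keys p. Poly_Mapping.keys m \<subseteq> {..n}}\<rparr>"

definition constants :: "'k::field mpoly set"
  where "constants = {Poly_Mapping.single 0 c | c. True}"

text \<open>The degree-\<open>t\<close> graded piece of \<open>coord_poly_ring n\<close>; it contains 0.\<close>

definition forms :: "nat \<Rightarrow> nat \<Rightarrow> 'k::field mpoly set"
  where "forms n t = {p. Poly_Mapping.keys p \<subseteq> monomials n t}"

definition nonzero_vectors :: "nat \<Rightarrow> (nat \<Rightarrow> 'k::field) set"
  where "nonzero_vectors n = {v. (\<forall>i>n. v i = 0) \<and> (\<exists>i\<le>n. v i \<noteq> 0)}"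

definition proportional :: "nat \<Rightarrow> ((nat \<Rightarrow> 'k::field) \<times> (nat \<Rightarrow> 'k)) set"
  where "proportional n = {(v, w). v \<in> nonzero_vectors n \<and> w \<in> nonzero_vectors n \<and>
    (\<exists>c. c \<noteq> 0 \<and> w = (\<lambda>i. c * v i))}"

definition proj_space :: "nat \<Rightarrow> (nat \<Rightarrow> 'k::field) set set"
  where "proj_space n = nonzero_vectors n // proportional n"

text \<open>
  Over an algebraically closed field, reduced closed subschemes of projective space are identified
  with their sets of closed points, i.e. with the common zero loci of sets of forms (of possibly
  different degrees).  The empty set is included.
\<close>

definition zero_locus :: "nat \<Rightarrow> 'k::field mpoly set \<Rightarrow> (nat \<Rightarrow> 'k) set set"
  where "zero_locus n F = {P \<in> proj_space n. \<forall>f\<in>F. \<forall>v\<in>P. eval_poly v f = 0}"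

definition projective_variety :: "nat \<Rightarrow> (nat \<Rightarrow> 'k::field) set set \<Rightarrow> bool"
  where "projective_variety n W \<longleftrightarrow> (\<exists>F. (\<forall>f\<in>F. \<exists>t. f \<in> forms n t) \<and> W = zero_locus n F)"

text \<open>
  Vanishing is required at all representatives of each point, so over an infinite field this ideal
  is homogeneous: it is the radical ideal generated by the forms vanishing on \<open>W\<close>.
  For the empty set it is the whole ring, and the Hilbert function is then 0.
\<close>

definition vanishing_ideal :: "nat \<Rightarrow> (nat \<Rightarrow> 'k::field) set set \<Rightarrow> 'k mpoly set"
  where "vanishing_ideal n W =
    {p \<in> carrier (coord_poly_ring n). \<forall>P\<in>W. \<forall>v\<in>P. eval_poly v p = 0}"

definition coordinate_ring :: "nat \<Rightarrow> (nat \<Rightarrow> 'k::field) set set \<Rightarrow> 'k mpoly set ring"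
  where "coordinate_ring n W = coord_poly_ring n Quot vanishing_ideal n W"

definition residue_class ::
    "nat \<Rightarrow> (nat \<Rightarrow> 'k::field) set set \<Rightarrow> 'k mpoly \<Rightarrow> 'k mpoly set"
  where "residue_class n W p = vanishing_ideal n W +>\<^bsub>coord_poly_ring n\<^esub> p"

text \<open>
  The dimension of the degree-\<open>t\<close> piece of the homogeneous coordinate ring over the (image of the)
  field of constants.
\<close>

definition hilbert_function :: "nat \<Rightarrow> (nat \<Rightarrow> 'k::field) set set \<Rightarrow> nat \<Rightarrow> nat"
  where "hilbert_function n W t =
    ring.dim (coordinate_ring n W) (residue_class n W ` constants) (residue_class n W ` forms n t)"

text \<open>
  The order of the coordinates of the Veronese embedding is a parameter: \<open>e\<close> is meant to be a
  bijection from \<open>{..N}\<close> onto \<open>monomials n d\<close>; one exists by \<open>ex_monomial_enumeration\<close>.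
\<close>

definition veronese_vec ::
    "nat \<Rightarrow> (nat \<Rightarrow> nat \<Rightarrow>\<^sub>0 nat) \<Rightarrow> (nat \<Rightarrow> 'k::field) \<Rightarrow> nat \<Rightarrow> 'k"
  where "veronese_vec N e v = (\<lambda>j. if j \<le> N then eval_mon v (e j) else 0)"

text \<open>The union of the proportionality classes of the images of all representatives, which is one
  such class.\<close>

definition veronese_map ::
    "nat \<Rightarrow> (nat \<Rightarrow> nat \<Rightarrow>\<^sub>0 nat) \<Rightarrow> (nat \<Rightarrow> 'k::field) set \<Rightarrow> (nat \<Rightarrow> 'k) set"
  where "veronese_map N e P = proportional N `` (veronese_vec N e ` P)"

definition veronese_variety ::
    "nat \<Rightarrow> nat \<Rightarrow> (nat \<Rightarrow> nat \<Rightarrow>\<^sub>0 nat) \<Rightarrow> (nat \<Rightarrow> 'k::field) set set"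
  where "veronese_variety n N e = veronese_map N e ` proj_space n"

end

theory Submission
  imports Defs
begin

text \<open>
  Substituting the monomial \<open>e j\<close> for the \<open>j\<close>-th variable gives a ring homomorphism that maps the
  forms of degree \<open>t\<close> in \<open>N + 1\<close> variables onto the forms of degree \<open>d t\<close> in \<open>n + 1\<close> variables, and a
  polynomial vanishes on the Veronese image of \<open>Y\<close> iff its pullback vanishes on \<open>Y\<close>.  So the coordinate
  ring of the image of \<open>Y\<close> embeds into that of \<open>Y\<close>, its degree \<open>t\<close> piece being the degree \<open>d t\<close> piece of
  the latter, which relates the Hilbert functions.  It remains to see that closed subsets of the
  Veronese variety are exactly the images of closed sets.  Preimages are cut out by pullbacks.
  For images, the relations among monomials of degree \<open>d\<close> force a point onto the Veronese variety, and
  a form \<open>f\<close> of degree \<open>s\<close> can be replaced by the products \<open>x\<^sub>i\<^bsup>(d-1)s\<^esup> f\<close>, which are pullbacks.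
\<close>

section \<open>Dimension along injective ring homomorphisms\<close>

text \<open>A space with a dimension grows out of the zero space by line extensions, and both facts
  survive each step. Here \<open>K\<close> is just a set of scalars containing zero, not a
  subfield.\<close>

lemma (in ring) dimension_subset:
  assumes "dimension n K E" and "K \<subseteq> carrier R" and "\<zero> \<in> K"
  shows "E \<subseteq> carrier R" and "\<zero> \<in> E"
  using assms
proof (induction rule: dimension.induct)
  case (Suc_dim v E n K)
  {
    case 1
    then show ?case using Suc_dim by (auto simp: line_extension_def set_add_def' r_coset_def)
  next
    case 2
    have "\<zero> = \<zero> \<otimes> v \<oplus> \<zero>" using Suc_dim by simp
    then show ?case using Suc_dim 2 unfolding line_extension_mem_iff by blast
  }
qed auto

lemma (in ring_hom_ring) image_line_extension:
  assumes "K \<subseteq> carrier R" "v \<in> carrier R" "E \<subseteq> carrier R"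
  shows "h ` R.line_extension K v E = S.line_extension (h ` K) (h v) (h ` E)"
proof (rule Set.set_eqI)
  fix y
  have "y \<in> h ` R.line_extension K v E \<longleftrightarrow> (\<exists>k\<in>K. \<exists>u\<in>E. y = h (k \<otimes>\<^bsub>R\<^esub> v \<oplus>\<^bsub>R\<^esub> u))"
    unfolding image_iff Bex_def R.line_extension_mem_iff by blast
  also have "\<dots> \<longleftrightarrow> (\<exists>k\<in>K. \<exists>u\<in>E. y = h k \<otimes>\<^bsub>S\<^esub> h v \<oplus>\<^bsub>S\<^esub> h u)"
    using assms by (intro bex_cong refl) (simp add: subset_iff)
  also have "\<dots> \<longleftrightarrow> y \<in> S.line_extension (h ` K) (h v) (h ` E)"
    unfolding S.line_extension_mem_iff by blast
  finally show "y \<in> h ` R.line_extension K v E \<longleftrightarrow> y \<in> S.line_extension (h ` K) (h v) (h ` E)" .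
qed

text \<open>A chain of line extensions is carried over by \<open>h\<close>; injectivity keeps each
  new vector outside the image of the space built so far.\<close>

lemma (in ring_hom_ring) inj_image_dimension:
  assumes inj: "inj_on h (carrier R)"
    and "R.dimension n K E" "K \<subseteq> carrier R" "\<zero>\<^bsub>R\<^esub> \<in> K"
  shows "S.dimension n (h ` K) (h ` E)"
  using assms(2-)
proof (induction rule: R.dimension.induct)
  case (Suc_dim v E n K)
  then have E: "E \<subseteq> carrier R" by (metis R.dimension_subset(1))
  with inj Suc_dim have "h v \<notin> h ` E" by (simp add: inj_on_image_mem_iff)
  with Suc_dim E show ?case by (auto simp: image_line_extension intro!: S.dimension.Suc_dim)
qed simp

text \<open>Lifts a chain of line extensions back through \<open>h\<close>. The scalars zero and one
  in \<open>K\<close> place both the smaller space and the new vector inside the image of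
  \<open>E\<close>, so both have preimages in \<open>E\<close>, and injectivity recovers
  \<open>E\<close> as their line extension.\<close>

lemma (in ring_hom_ring) dimension_of_inj_image:
  assumes inj: "inj_on h (carrier R)"
    and "S.dimension n K' E'"
    and K: "K' = h ` K" "K \<subseteq> carrier R" "\<zero>\<^bsub>R\<^esub> \<in> K" "\<one>\<^bsub>R\<^esub> \<in> K"
    and "E' = h ` E" "E \<subseteq> carrier R"
  shows "R.dimension n K E"
  using assms(2-)
proof (induction arbitrary: E rule: S.dimension.induct)
  case (zero_dim K')
  then have "E = {\<zero>\<^bsub>R\<^esub>}"
    using inj by (metis R.zero_closed empty_subsetI hom_zero image_empty image_insert inj_on_image_eq_iff
        insert_subset)
  then show ?case by simp
next
  case (Suc_dim v F n K')
  note K = Suc_dim.prems(1-4) and E = Suc_dim.prems(5,6)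
  have K': "K' \<subseteq> carrier S" "\<zero>\<^bsub>S\<^esub> \<in> K'" "\<one>\<^bsub>S\<^esub> \<in> K'"
    using K by (auto intro: rev_image_eqI)
  have F: "F \<subseteq> carrier S" "\<zero>\<^bsub>S\<^esub> \<in> F" using S.dimension_subset[OF Suc_dim.hyps(3) K'(1,2)] by auto
  \<comment> \<open>Coefficient one on \<open>v\<close> and the zero vector of \<open>F\<close>
    exhibit \<open>v\<close> itself as a member of the line extension.\<close>
  have "v = \<one>\<^bsub>S\<^esub> \<otimes>\<^bsub>S\<^esub> v \<oplus>\<^bsub>S\<^esub> \<zero>\<^bsub>S\<^esub>" using Suc_dim.hyps by simp
  then have "v \<in> h ` E" using K' F unfolding E(1)[symmetric] S.line_extension_mem_iff by blast
  then obtain w where w: "w \<in> E" "v = h w" by blast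
  have "F \<subseteq> h ` E"
  proof
    fix x assume "x \<in> F"
    moreover from this have "x = \<zero>\<^bsub>S\<^esub> \<otimes>\<^bsub>S\<^esub> v \<oplus>\<^bsub>S\<^esub> x" using F Suc_dim.hyps by auto
    ultimately show "x \<in> h ` E" using K' unfolding E(1)[symmetric] S.line_extension_mem_iff by blast
  qed
  then obtain F0 where F0: "F0 \<subseteq> E" "F = h ` F0" by (meson subset_imageE)
  have "h ` R.line_extension K w F0 = h ` E"
    using K(2) w F0 E by (subst image_line_extension) (auto simp: K(1))
  moreover have "R.line_extension K w F0 \<subseteq> carrier R"
    using K(2) w(1) F0(1) E(2) by (auto simp: R.line_extension_mem_iff subset_iff)
  ultimately have "R.line_extension K w F0 = E" using inj E(2) by (simp add: inj_on_image_eq_iff)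
  moreover have "R.dimension n K F0" using Suc_dim.IH K F0 E(2) by blast
  moreover have "w \<notin> F0" using Suc_dim.hyps w F0 by auto
  ultimately show ?case using R.dimension.Suc_dim[of w F0 n K] w(1) E(2) by auto
qed

text \<open>\<open>dim\<close> depends only on the predicate \<open>dimension\<close>, so it is
  enough that this predicate holds for the same numbers on both sides.\<close>

lemma (in ring_hom_ring) dim_inj_image:
  assumes "inj_on h (carrier R)" "K \<subseteq> carrier R" "\<zero>\<^bsub>R\<^esub> \<in> K" "\<one>\<^bsub>R\<^esub> \<in> K" "E \<subseteq> carrier R"
  shows "S.dim (h ` K) (h ` E) = R.dim K E"
proof -
  have "S.dimension n (h ` K) (h ` E) \<longleftrightarrow> R.dimension n K E" for n
    using inj_image_dimension[of n K E] dimension_of_inj_image[of n "h ` K" "h ` E" K E] assms by blast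
  then show ?thesis by (simp add: S.dim_def R.dim_def)
qed

text \<open>The composite of \<open>\<phi>\<close> with the projection to \<open>B Quot J\<close>
  has kernel \<open>I\<close>. The induced map embeds \<open>A Quot I\<close> into
  \<open>B Quot J\<close>, and dimension is preserved by an injective ring homomorphism.\<close>

lemma dim_quotients_eq:
  assumes "ring A" and "ideal J B" and \<phi>: "\<phi> \<in> ring_hom A B"
    and I: "I \<subseteq> carrier A" "\<And>x. x \<in> carrier A \<Longrightarrow> x \<in> I \<longleftrightarrow> \<phi> x \<in> J"
    and K: "K \<subseteq> carrier A" "\<zero>\<^bsub>A\<^esub> \<in> K" "\<one>\<^bsub>A\<^esub> \<in> K" and E: "E \<subseteq> carrier A"
  shows "ring.dim (A Quot I) ((+>\<^bsub>A\<^esub>) I ` K) ((+>\<^bsub>A\<^esub>) I ` E) =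
    ring.dim (B Quot J) ((+>\<^bsub>B\<^esub>) J ` \<phi> ` K) ((+>\<^bsub>B\<^esub>) J ` \<phi> ` E)"
proof -
  interpret A: ring A by fact
  interpret J: ideal J B by fact
  interpret Q: ring "B Quot J" by (rule J.quotient_is_ring)
  define g where "g = a_r_coset B J \<circ> \<phi>"
  have "g \<in> ring_hom A (B Quot J)"
    unfolding g_def using \<phi> J.rcos_ring_hom by (rule ring_hom_trans)
  then interpret g: ring_hom_ring A "B Quot J" g
    by (intro ring_hom_ringI2 A.ring_axioms Q.ring_axioms)
  have ker: "a_kernel A (B Quot J) g = I"
  proof -
    have "\<phi> x \<in> J \<longleftrightarrow> J +>\<^bsub>B\<^esub> \<phi> x = J" if "x \<in> carrier A" for x
      using ring_hom_closed[OF \<phi> that] J.a_rcos_const J.a_rcos_self by metis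
    then show ?thesis using I by (auto simp: a_kernel_def' g_def FactRing_def)
  qed
  define f where "f = (\<lambda>C. the_elem (g ` C))"
  \<comment> \<open>That \<open>I\<close> is an ideal comes from its being a kernel.\<close>
  interpret I: ideal I A using g.kernel_is_ideal by (simp add: ker)
  interpret QI: ring "A Quot I" by (rule I.quotient_is_ring)
  interpret f: ring_hom_ring "A Quot I" "B Quot J" f
    unfolding f_def using g.the_elem_hom
    by (intro ring_hom_ringI2 QI.ring_axioms Q.ring_axioms) (simp add: ker)
  have coset: "f (I +>\<^bsub>A\<^esub> x) = J +>\<^bsub>B\<^esub> \<phi> x" if "x \<in> carrier A" for x
    using g.the_elem_simp[OF that] unfolding ker by (simp add: f_def g_def)
  have "inj_on f (carrier (A Quot I))"
    by (intro inj_onI g.the_elem_inj) (simp_all add: ker f_def)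
  moreover have sub: "(+>\<^bsub>A\<^esub>) I ` L \<subseteq> carrier (A Quot I)" if "L \<subseteq> carrier A" for L
    using ring_hom_closed[OF I.rcos_ring_hom] that by auto
  moreover have "\<zero>\<^bsub>A Quot I\<^esub> \<in> (+>\<^bsub>A\<^esub>) I ` K" "\<one>\<^bsub>A Quot I\<^esub> \<in> (+>\<^bsub>A\<^esub>) I ` K"
    using ring_hom_zero[OF I.rcos_ring_hom A.ring_axioms QI.ring_axioms]
      ring_hom_one[OF I.rcos_ring_hom] K by (metis imageI)+
  ultimately have "ring.dim (B Quot J) (f ` (+>\<^bsub>A\<^esub>) I ` K) (f ` (+>\<^bsub>A\<^esub>) I ` E) =
      ring.dim (A Quot I) ((+>\<^bsub>A\<^esub>) I ` K) ((+>\<^bsub>A\<^esub>) I ` E)"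
    using K E by (intro f.dim_inj_image) auto
  moreover have "f ` (+>\<^bsub>A\<^esub>) I ` L = (+>\<^bsub>B\<^esub>) J ` \<phi> ` L" if "L \<subseteq> carrier A" for L
    using that coset by (force simp: image_image subset_iff intro: image_cong)
  ultimately show ?thesis using K E by simp
qed

section \<open>Polynomial substitution\<close>

lemma coord_poly_ring_simps [simp]:
  "carrier (coord_poly_ring n) = {p. \<forall>m\<in>Poly_Mapping.keys p. Poly_Mapping.keys m \<subseteq> {..n}}"
  "monoid.mult (coord_poly_ring n) = (*)" "monoid.one (coord_poly_ring n) = 1"
  "ring.zero (coord_poly_ring n) = 0" "ring.add (coord_poly_ring n) = (+)"
  by (auto simp: coord_poly_ring_def ring_of_type_algebra_def)

lemma coord_poly_ring_mult_closed:
  assumes "p \<in> carrier (coord_poly_ring n)" "q \<in> carrier (coord_poly_ring n)"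
  shows "p * q \<in> carrier (coord_poly_ring n)"
proof -
  have "Poly_Mapping.keys m \<subseteq> {..n}" if "m \<in> Poly_Mapping.keys (p * q)" for m
  proof -
    from that obtain a b where "m = a + b" "a \<in> Poly_Mapping.keys p" "b \<in> Poly_Mapping.keys q"
      using keys_mult by blast
    then show ?thesis using assms keys_add[of a b] by fastforce
  qed
  then show ?thesis by simp
qed

lemma coord_poly_ring_add_closed:
  assumes "p \<in> carrier (coord_poly_ring n)" "q \<in> carrier (coord_poly_ring n)"
  shows "p + q \<in> carrier (coord_poly_ring n)"
  using assms keys_add[of p q] by auto

text \<open>All polynomials of the type form a ring, and those in the variables up to
  \<open>n\<close> are closed under its operations, hence a subring.\<close>

lemma ring_coord_poly_ring: "ring (coord_poly_ring n :: 'k::field mpoly ring)"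
proof -
  interpret T: ring "ring_of_type_algebra :: 'k mpoly ring" by (rule ring_from_type_algebra)
  have uminus: "\<ominus>\<^bsub>ring_of_type_algebra\<^esub> p = - p" for p :: "'k mpoly"
    by (rule T.minus_equality) (auto simp: ring_of_type_algebra_def)
  have "subring (carrier (coord_poly_ring n)) (ring_of_type_algebra :: 'k mpoly ring)"
  proof (rule T.subringI)
    fix p q :: "'k mpoly" assume "p \<in> carrier (coord_poly_ring n)" "q \<in> carrier (coord_poly_ring n)"
    then show "\<ominus>\<^bsub>ring_of_type_algebra\<^esub> p \<in> carrier (coord_poly_ring n)"
      "p \<otimes>\<^bsub>ring_of_type_algebra\<^esub> q \<in> carrier (coord_poly_ring n)"
      "p \<oplus>\<^bsub>ring_of_type_algebra\<^esub> q \<in> carrier (coord_poly_ring n)"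
      using coord_poly_ring_mult_closed[of p n q] coord_poly_ring_add_closed[of p n q]
      unfolding uminus by (simp_all add: ring_of_type_algebra_def)
  qed (auto simp: ring_of_type_algebra_def)
  from T.subring_is_ring[OF this] show ?thesis by (simp add: coord_poly_ring_def)
qed

section \<open>Evaluation of monomials and polynomials\<close>

lemma single_power: "Poly_Mapping.single (Poly_Mapping.single i 1) 1 ^ k =
    (Poly_Mapping.single (Poly_Mapping.single i k) 1 :: (nat \<Rightarrow>\<^sub>0 nat) \<Rightarrow>\<^sub>0 'a::comm_ring_1)"
  by (induction k) (simp_all add: mult_single single_add[symmetric])

lemma prod_single: "(\<Prod>i\<in>A. Poly_Mapping.single (f i) 1) =
    (Poly_Mapping.single (\<Sum>i\<in>A. f i) 1 :: (nat \<Rightarrow>\<^sub>0 nat) \<Rightarrow>\<^sub>0 'a::comm_ring_1)"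
  by (induction A rule: infinite_finite_induct) (simp_all add: mult_single)

text \<open>Serves at two types: it writes a polynomial as the sum of its terms, and an exponent
  vector as the sum of its one-variable parts.\<close>

lemma single_sum_poly: "(\<Sum>m\<in>Poly_Mapping.keys p. Poly_Mapping.single m (Poly_Mapping.lookup p m)) = p"
  by (rule poly_mapping_eqI)
    (simp add: lookup_sum lookup_single when_def in_keys_iff sum.delta)

lemma eval_mon_eq_prod:
  assumes "finite A" "Poly_Mapping.keys m \<subseteq> A"
  shows "eval_mon v m = (\<Prod>i\<in>A. v i ^ Poly_Mapping.lookup m i)"
  unfolding eval_mon_def using assms
  by (intro prod.mono_neutral_left) (auto simp: in_keys_iff)

lemma eval_mon_zero [simp]: "eval_mon v 0 = 1"
  by (simp add: eval_mon_def)

lemma eval_mon_single [simp]: "eval_mon v (Poly_Mapping.single i k) = v i ^ k"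
  by (simp add: eval_mon_def)

lemma eval_mon_add: "eval_mon v (a + b) = eval_mon v a * eval_mon v b"
  using keys_add[of a b]
  by (simp add: eval_mon_eq_prod[of "Poly_Mapping.keys a \<union> Poly_Mapping.keys b"]
      lookup_add power_add prod.distrib)

lemma eval_mon_mult: "eval_mon (\<lambda>i. v i * w i) m = eval_mon v m * eval_mon w m"
  by (simp add: eval_mon_def power_mult_distrib prod.distrib)

lemma eval_mon_power: "eval_mon (\<lambda>i. v i ^ k) m = eval_mon v m ^ k"
  by (simp add: eval_mon_def prod_power_distrib power_mult[symmetric] mult.commute)

text \<open>Together with \<open>eval_mon_mult\<close> this yields homogeneity: scaling the argument
  by \<open>c\<close> scales a monomial by \<open>c ^ mon_degree m\<close>.\<close>

lemma eval_mon_const: "eval_mon (\<lambda>i. c) m = c ^ mon_degree m"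
  by (simp add: eval_mon_def mon_degree_def power_sum)

lemma eval_mon_cong:
  "(\<And>i. i \<in> Poly_Mapping.keys m \<Longrightarrow> v i = w i) \<Longrightarrow> eval_mon v m = eval_mon w m"
  by (simp add: eval_mon_def)

text \<open>A monomial is its own value at the variables, so the laws for \<open>eval_mon\<close>
  also prove identities between monomials.\<close>

lemma single_eq_eval_mon:
  "Poly_Mapping.single m 1 = eval_mon (\<lambda>i. Poly_Mapping.single (Poly_Mapping.single i 1) 1) m"
  by (simp only: eval_mon_def single_power prod_single single_sum_poly)

text \<open>The coefficient map \<open>c\<close> lets one set of lemmas cover both evaluation at a
  vector, where \<open>c\<close> is the identity, and substitution of polynomials for variables,
  where \<open>c\<close> embeds scalars as constants.\<close>

definition subst_poly :: "('a \<Rightarrow> 'b) \<Rightarrow> (nat \<Rightarrow> 'b) \<Rightarrow> ((nat \<Rightarrow>\<^sub>0 nat) \<Rightarrow>\<^sub>0 'a::comm_ring_1) \<Rightarrow> 'b::comm_ring_1"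
  where "subst_poly c v p =
    (\<Sum>m\<in>Poly_Mapping.keys p. c (Poly_Mapping.lookup p m) * eval_mon v m)"

lemma eval_poly_eq_subst: "eval_poly v = subst_poly (\<lambda>a. a) v"
  by (simp add: fun_eq_iff eval_poly_def subst_poly_def)

context
  fixes c :: "'a::comm_ring_1 \<Rightarrow> 'b::comm_ring_1"
  assumes c0: "c 0 = 0" and c1: "c 1 = 1"
    and c_add: "\<And>x y. c (x + y) = c x + c y" and c_mult: "\<And>x y. c (x * y) = c x * c y"
begin

lemma subst_poly_single: "subst_poly c v (Poly_Mapping.single m a) = c a * eval_mon v m"
  by (simp add: subst_poly_def c0)

lemma subst_poly_zero: "subst_poly c v 0 = 0"
  by (simp add: subst_poly_def)

lemma subst_poly_one: "subst_poly c v 1 = 1"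
  by (simp add: subst_poly_def c1)

lemma subst_poly_add: "subst_poly c v (p + q) = subst_poly c v p + subst_poly c v q"
  unfolding subst_poly_def
  by (rule setsum_keys_plus_distrib) (simp_all add: c0 c_add distrib_right)

lemma subst_poly_uminus: "subst_poly c v (- p) = - subst_poly c v p"
  using subst_poly_add[of v p "- p"] by (simp add: subst_poly_zero eq_neg_iff_add_eq_0 add.commute)

lemma subst_poly_diff: "subst_poly c v (p - q) = subst_poly c v p - subst_poly c v q"
  using subst_poly_add[of v p "- q"] by (simp add: subst_poly_uminus)

lemma subst_poly_sum: "subst_poly c v (\<Sum>i\<in>A. f i) = (\<Sum>i\<in>A. subst_poly c v (f i))"
  by (induction A rule: infinite_finite_induct) (simp_all add: subst_poly_zero subst_poly_add)

text \<open>Expanding both factors into terms reduces the claim to products of two terms, where it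
  is \<open>eval_mon_add\<close> and multiplicativity of \<open>c\<close>.\<close>

lemma subst_poly_mult: "subst_poly c v (p * q) = subst_poly c v p * subst_poly c v q"
proof -
  have "subst_poly c v (p * q) = subst_poly c v
    ((\<Sum>a\<in>Poly_Mapping.keys p. Poly_Mapping.single a (Poly_Mapping.lookup p a)) *
     (\<Sum>b\<in>Poly_Mapping.keys q. Poly_Mapping.single b (Poly_Mapping.lookup q b)))"
    by (simp only: single_sum_poly)
  also have "\<dots> = subst_poly c v p * subst_poly c v q"
    by (simp add: sum_product mult_single subst_poly_sum subst_poly_single c_mult eval_mon_add mult_ac)
      (simp add: subst_poly_def sum_product mult_ac)
  finally show ?thesis .
qed

lemma subst_poly_power: "subst_poly c v (p ^ k) = subst_poly c v p ^ k"
  by (induction k) (simp_all add: subst_poly_one subst_poly_mult)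

lemma subst_poly_prod: "subst_poly c v (\<Prod>i\<in>A. f i) = (\<Prod>i\<in>A. subst_poly c v (f i))"
  by (induction A rule: infinite_finite_induct) (simp_all add: subst_poly_one subst_poly_mult)

lemma subst_poly_eval_mon: "subst_poly c v (eval_mon w m) = eval_mon (\<lambda>i. subst_poly c v (w i)) m"
  by (simp add: eval_mon_def subst_poly_prod subst_poly_power)

end

lemmas eval_poly_hom =
  subst_poly_single[of "\<lambda>a. a", folded eval_poly_eq_subst, simplified]
  subst_poly_zero[of "\<lambda>a. a", folded eval_poly_eq_subst, simplified]
  subst_poly_one[of "\<lambda>a. a", folded eval_poly_eq_subst, simplified]
  subst_poly_add[of "\<lambda>a. a", folded eval_poly_eq_subst, simplified]
  subst_poly_uminus[of "\<lambda>a. a", folded eval_poly_eq_subst, simplified]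
  subst_poly_diff[of "\<lambda>a. a", folded eval_poly_eq_subst, simplified]
  subst_poly_sum[of "\<lambda>a. a", folded eval_poly_eq_subst, simplified]
  subst_poly_mult[of "\<lambda>a. a", folded eval_poly_eq_subst, simplified]
  subst_poly_power[of "\<lambda>a. a", folded eval_poly_eq_subst, simplified]
  subst_poly_eval_mon[of "\<lambda>a. a", folded eval_poly_eq_subst, simplified]

section \<open>Forms\<close>

lemma mon_degree_add: "mon_degree (a + b) = mon_degree a + mon_degree b"
  unfolding mon_degree_def by (rule setsum_keys_plus_distrib) simp_all

lemma mon_degree_single [simp]: "mon_degree (Poly_Mapping.single i k) = k"
  by (simp add: mon_degree_def)

lemma zero_in_monomials: "0 \<in> monomials n 0"
  by (simp add: monomials_def mon_degree_def)

lemma single_in_monomials: "i \<le> n \<Longrightarrow> Poly_Mapping.single i k \<in> monomials n k"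
  by (simp add: monomials_def)

lemma add_in_monomials: "a \<in> monomials n s \<Longrightarrow> b \<in> monomials n t \<Longrightarrow> a + b \<in> monomials n (s + t)"
  using keys_add[of a b] by (fastforce simp: monomials_def mon_degree_add)

lemma monomials_SucE:
  assumes "m \<in> monomials n (Suc t)"
  obtains i m' where "i \<le> n" "m' \<in> monomials n t" "m = Poly_Mapping.single i 1 + m'"
proof -
  from assms obtain i where i: "i \<in> Poly_Mapping.keys m"
    by (fastforce simp: monomials_def mon_degree_def)
  \<comment> \<open>Subtraction of exponents is truncated, but exact here because the exponent of
    \<open>i\<close> in \<open>m\<close> is positive.\<close>
  define m' where "m' = m - Poly_Mapping.single i 1"
  have m: "m = Poly_Mapping.single i 1 + m'"
    using i by (intro poly_mapping_eqI)
      (auto simp: m'_def lookup_add lookup_minus lookup_single when_def in_keys_iff)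
  moreover have "Poly_Mapping.keys m' \<subseteq> Poly_Mapping.keys m"
    by (auto simp: m'_def in_keys_iff lookup_minus)
  moreover have "mon_degree m = Suc (mon_degree m')"
    by (subst m) (simp add: mon_degree_add)
  ultimately show thesis using assms i by (intro that[of i m']) (auto simp: monomials_def)
qed

text \<open>The variables of the factor of degree \<open>s\<close> are split off one at a
  time.\<close>

lemma monomials_addE:
  assumes "m \<in> monomials n (s + t)"
  obtains a b where "a \<in> monomials n s" "b \<in> monomials n t" "m = a + b"
proof -
  have "\<exists>a\<in>monomials n s. \<exists>b\<in>monomials n t. m = a + b"
    using assms
  proof (induction s arbitrary: m)
    case 0
    then show ?case using zero_in_monomials by force
  next
    case (Suc s)
    then obtain i m' where i: "i \<le> n" "m' \<in> monomials n (s + t)" "m = Poly_Mapping.single i 1 + m'"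
      by (metis add_Suc monomials_SucE)
    with Suc.IH obtain a b where "a \<in> monomials n s" "b \<in> monomials n t" "m' = a + b" by blast
    with i add_in_monomials[OF single_in_monomials[OF i(1), of 1], of a s] show ?case
      by (intro bexI[of _ "Poly_Mapping.single i 1 + a"] bexI[of _ b]) (simp_all add: add.assoc)
  qed
  with that show thesis by blast
qed

lemma single_in_forms: "m \<in> monomials n t \<Longrightarrow> Poly_Mapping.single m a \<in> forms n t"
  by (simp add: forms_def)

lemma one_in_forms: "1 \<in> forms n 0"
  using zero_in_monomials by (simp add: forms_def)

lemma mult_in_forms: "f \<in> forms n s \<Longrightarrow> g \<in> forms n t \<Longrightarrow> f * g \<in> forms n (s + t)"
  using keys_mult[of f g] add_in_monomials[of _ n s _ t] by (fastforce simp: forms_def)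

lemma diff_in_forms: "f \<in> forms n t \<Longrightarrow> g \<in> forms n t \<Longrightarrow> f - g \<in> forms n t"
  using keys_diff[of f g] by (auto simp: forms_def)

lemma sum_in_forms: "(\<And>i. i \<in> A \<Longrightarrow> f i \<in> forms n t) \<Longrightarrow> (\<Sum>i\<in>A. f i) \<in> forms n t"
  using keys_sum[of f A] by (fastforce simp: forms_def)

lemma power_in_forms: "f \<in> forms n s \<Longrightarrow> f ^ k \<in> forms n (k * s)"
  by (induction k) (simp_all add: one_in_forms mult_in_forms)

lemma prod_in_forms:
  "(\<And>i. i \<in> A \<Longrightarrow> f i \<in> forms n (t i)) \<Longrightarrow> (\<Prod>i\<in>A. f i) \<in> forms n (\<Sum>i\<in>A. t i)"
  by (induction A rule: infinite_finite_induct) (simp_all add: one_in_forms mult_in_forms)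

text \<open>Degrees add along the product. It is used with \<open>s = d\<close> for pullbacks and
  with \<open>s = 1\<close> for monomials in chosen coordinates.\<close>

lemma eval_mon_in_forms:
  assumes "\<And>i. i \<in> Poly_Mapping.keys m \<Longrightarrow> v i \<in> forms n s"
  shows "eval_mon v m \<in> forms n (s * mon_degree m)"
proof -
  have "eval_mon v m \<in> forms n (\<Sum>i\<in>Poly_Mapping.keys m. Poly_Mapping.lookup m i * s)"
    unfolding eval_mon_def using assms by (intro prod_in_forms power_in_forms)
  then show ?thesis by (simp add: mon_degree_def sum_distrib_left mult.commute)
qed

lemma forms_subset_carrier: "forms n t \<subseteq> carrier (coord_poly_ring n)"
  by (auto simp: forms_def monomials_def)

lemma sum_in_carrier:
  "(\<And>i. i \<in> A \<Longrightarrow> f i \<in> carrier (coord_poly_ring n)) \<Longrightarrow>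
    (\<Sum>i\<in>A. f i) \<in> carrier (coord_poly_ring n)"
  using keys_sum[of f A] by fastforce

lemma constants_subset_carrier: "constants \<subseteq> carrier (coord_poly_ring n)"
  by (auto simp: constants_def split: if_splits)

text \<open>Evaluation at a fixed vector is additive and multiplicative, so vanishing there survives
  sums and arbitrary multiples.\<close>

lemma ideal_vanishing_ideal:
  "ideal (vanishing_ideal n W) (coord_poly_ring n :: 'k::field mpoly ring)"
proof -
  interpret R: ring "coord_poly_ring n :: 'k mpoly ring" by (rule ring_coord_poly_ring)
  have uminus: "\<ominus>\<^bsub>coord_poly_ring n\<^esub> p = - p" if "p \<in> carrier (coord_poly_ring n)" for p :: "'k mpoly"
    using that by (intro R.minus_equality) auto
  show ?thesis
  proof (intro idealI R.ring_axioms R.add.subgroupI)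
    show "vanishing_ideal n W \<noteq> {}"
      by (auto simp: vanishing_ideal_def eval_poly_hom intro!: exI[of _ 0])
  next
    fix p assume "p \<in> vanishing_ideal n W"
    then show "\<ominus>\<^bsub>coord_poly_ring n\<^esub> p \<in> vanishing_ideal n W"
      by (subst uminus) (auto simp: vanishing_ideal_def eval_poly_hom)
  next
    fix p q :: "'k mpoly" assume "p \<in> vanishing_ideal n W" "q \<in> vanishing_ideal n W"
    then show "p \<oplus>\<^bsub>coord_poly_ring n\<^esub> q \<in> vanishing_ideal n W"
      using coord_poly_ring_add_closed[of p n q] by (auto simp: vanishing_ideal_def eval_poly_hom)
  next
    fix p q :: "'k mpoly" assume "p \<in> vanishing_ideal n W" "q \<in> carrier (coord_poly_ring n)"
    then show "q \<otimes>\<^bsub>coord_poly_ring n\<^esub> p \<in> vanishing_ideal n W"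
      "p \<otimes>\<^bsub>coord_poly_ring n\<^esub> q \<in> vanishing_ideal n W"
      using coord_poly_ring_mult_closed[of p n q] coord_poly_ring_mult_closed[of q n p]
      by (auto simp: vanishing_ideal_def eval_poly_hom)
  qed (auto simp: vanishing_ideal_def)
qed

section \<open>Points of projective space\<close>

lemma equiv_proportional:
  "equiv (nonzero_vectors n) (proportional n :: ((nat \<Rightarrow> 'k::field) \<times> (nat \<Rightarrow> 'k)) set)"
proof (rule equivI)
  show "proportional n \<subseteq> nonzero_vectors n \<times> (nonzero_vectors n :: (nat \<Rightarrow> 'k) set)"
    by (auto simp: proportional_def)
  show "refl_on (nonzero_vectors n :: (nat \<Rightarrow> 'k) set) (proportional n)"
    by (auto simp: proportional_def intro!: refl_onI exI[of _ 1])
  show "sym (proportional n :: ((nat \<Rightarrow> 'k) \<times> (nat \<Rightarrow> 'k)) set)"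
  proof (rule symI)
    fix v w :: "nat \<Rightarrow> 'k" assume "(v, w) \<in> proportional n"
    then obtain c where "v \<in> nonzero_vectors n" "w \<in> nonzero_vectors n" "c \<noteq> 0" "w = (\<lambda>i. c * v i)"
      by (auto simp: proportional_def)
    then show "(w, v) \<in> proportional n"
      by (auto simp: proportional_def intro!: exI[of _ "inverse c"])
  qed
  show "trans (proportional n :: ((nat \<Rightarrow> 'k) \<times> (nat \<Rightarrow> 'k)) set)"
  proof (rule transI)
    fix u v w :: "nat \<Rightarrow> 'k" assume "(u, v) \<in> proportional n" "(v, w) \<in> proportional n"
    then obtain b c where "u \<in> nonzero_vectors n" "w \<in> nonzero_vectors n" "b \<noteq> 0" "v = (\<lambda>i. b * u i)"
      "c \<noteq> 0" "w = (\<lambda>i. c * v i)"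
      by (auto simp: proportional_def)
    then show "(u, w) \<in> proportional n"
      by (auto simp: proportional_def mult.assoc intro!: exI[of _ "c * b"])
  qed
qed

lemma scaled_in_nonzero_vectors:
  "v \<in> nonzero_vectors n \<Longrightarrow> c \<noteq> 0 \<Longrightarrow> (\<lambda>i. c * v i) \<in> nonzero_vectors n"
  by (auto simp: nonzero_vectors_def)

lemma proportional_scaled:
  "v \<in> nonzero_vectors n \<Longrightarrow> c \<noteq> 0 \<Longrightarrow> (v, \<lambda>i. c * v i) \<in> proportional n"
  by (auto simp: proportional_def scaled_in_nonzero_vectors)

lemma proj_spaceD:
  assumes "P \<in> proj_space n" "v \<in> P"
  shows "v \<in> nonzero_vectors n" "P = proportional n `` {v}"
proof -
  from assms obtain u where u: "u \<in> nonzero_vectors n" "P = proportional n `` {u}"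
    by (auto simp: proj_space_def elim: quotientE)
  with assms show "v \<in> nonzero_vectors n" by (auto simp: proportional_def)
  show "P = proportional n `` {v}"
    using u assms equiv_class_eq[OF equiv_proportional, of u v n] by auto
qed

lemma proj_space_scaled:
  "P \<in> proj_space n \<Longrightarrow> v \<in> P \<Longrightarrow> c \<noteq> 0 \<Longrightarrow> (\<lambda>i. c * v i) \<in> P"
  using proj_spaceD[of P n v] proportional_scaled[of v n c] by auto

lemma proj_space_class:
  assumes "v \<in> nonzero_vectors n"
  shows "proportional n `` {v} \<in> proj_space n" "v \<in> proportional n `` {v}"
  using assms equiv_class_self[OF equiv_proportional] by (auto simp: proj_space_def intro: quotientI)

lemma proj_space_nonempty: "P \<in> proj_space n \<Longrightarrow> \<exists>v. v \<in> P"
  using in_quotient_imp_non_empty[OF equiv_proportional] by (auto simp: proj_space_def)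

section \<open>The Veronese embedding\<close>

locale veronese =
  fixes n d N :: nat and e :: "nat \<Rightarrow> nat \<Rightarrow>\<^sub>0 nat"
  assumes d_pos: "d > 0" and bij_e: "bij_betw e {..N} (monomials n d)"
begin

section \<open>The pullback of polynomials along the Veronese map\<close>

lemma e_in_monomials: "j \<le> N \<Longrightarrow> e j \<in> monomials n d"
  using bij_e by (auto simp: bij_betw_def)

lemma e_surj:
  assumes "m \<in> monomials n d" obtains j where "j \<le> N" "e j = m"
  using assms bij_e by (force simp: bij_betw_def)

text \<open>The comorphism of the Veronese embedding; \<open>Poly_Mapping.single 0\<close> embeds
  scalars as constant polynomials.\<close>

definition pullback :: "'k::field mpoly \<Rightarrow> 'k mpoly"
  where "pullback = subst_poly (Poly_Mapping.single 0) (\<lambda>j. Poly_Mapping.single (e j) 1)"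

lemma pullback_single:
  "pullback (Poly_Mapping.single m a) =
    Poly_Mapping.single 0 a * eval_mon (\<lambda>j. Poly_Mapping.single (e j) 1) m"
  unfolding pullback_def by (rule subst_poly_single) (simp_all add: single_add mult_single)

lemma pullback_single_var: "pullback (Poly_Mapping.single (Poly_Mapping.single j 1) 1) =
    Poly_Mapping.single (e j) 1"
  by (simp add: pullback_single)

lemma pullback_one: "pullback 1 = 1"
  unfolding pullback_def by (rule subst_poly_one) (simp_all add: single_add mult_single)

lemma pullback_add: "pullback (p + q) = pullback p + pullback q"
  unfolding pullback_def by (rule subst_poly_add) (simp_all add: single_add mult_single)

lemma pullback_diff: "pullback (p - q) = pullback p - pullback q"
  unfolding pullback_def by (rule subst_poly_diff) (simp_all add: single_add mult_single)

lemma pullback_sum: "pullback (\<Sum>i\<in>A. f i) = (\<Sum>i\<in>A. pullback (f i))"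
  unfolding pullback_def by (rule subst_poly_sum) (simp_all add: single_add mult_single)

lemma pullback_mult: "pullback (p * q) = pullback p * pullback q"
  unfolding pullback_def by (rule subst_poly_mult) (simp_all add: single_add mult_single)

lemma pullback_power: "pullback (p ^ k) = pullback p ^ k"
  unfolding pullback_def by (rule subst_poly_power) (simp_all add: single_add mult_single)

lemma pullback_eval_mon: "pullback (eval_mon v m) = eval_mon (\<lambda>i. pullback (v i)) m"
  unfolding pullback_def by (rule subst_poly_eval_mon) (simp_all add: single_add mult_single)

lemma pullback_monomial_in_forms:
  assumes "Poly_Mapping.keys m \<subseteq> {..N}"
  shows "Poly_Mapping.single 0 a * eval_mon (\<lambda>j. Poly_Mapping.single (e j) 1) m
    \<in> forms n (d * mon_degree m)"
proof -
  have "eval_mon (\<lambda>j. Poly_Mapping.single (e j) 1) m \<in> forms n (d * mon_degree m)"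
    using assms by (intro eval_mon_in_forms single_in_forms e_in_monomials) auto
  from mult_in_forms[OF single_in_forms[OF zero_in_monomials] this] show ?thesis by simp
qed

lemma pullback_in_forms:
  assumes "p \<in> forms N t"
  shows "pullback p \<in> forms n (d * t)"
  unfolding pullback_def subst_poly_def
proof (rule sum_in_forms)
  fix m assume "m \<in> Poly_Mapping.keys p"
  with assms have "Poly_Mapping.keys m \<subseteq> {..N}" "mon_degree m = t"
    by (auto simp: forms_def monomials_def)
  then show "Poly_Mapping.single 0 (Poly_Mapping.lookup p m) *
      eval_mon (\<lambda>j. Poly_Mapping.single (e j) 1) m \<in> forms n (d * t)"
    using pullback_monomial_in_forms by blast
qed

lemma pullback_in_carrier:
  assumes "p \<in> carrier (coord_poly_ring N)"
  shows "pullback p \<in> carrier (coord_poly_ring n)"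
  unfolding pullback_def subst_poly_def
proof (rule sum_in_carrier)
  fix m assume "m \<in> Poly_Mapping.keys p"
  with assms have "Poly_Mapping.keys m \<subseteq> {..N}" by auto
  then show "Poly_Mapping.single 0 (Poly_Mapping.lookup p m) *
      eval_mon (\<lambda>j. Poly_Mapping.single (e j) 1) m \<in> carrier (coord_poly_ring n)"
    using pullback_monomial_in_forms forms_subset_carrier by blast
qed

lemma ring_hom_pullback: "pullback \<in> ring_hom (coord_poly_ring N) (coord_poly_ring n)"
  by (rule ring_hom_memI)
    (simp_all add: pullback_in_carrier pullback_mult pullback_add pullback_one
      del: coord_poly_ring_simps(1))

text \<open>Evaluating after substitution is evaluating at the substituted values. The carrier
  condition matters because \<open>veronese_vec\<close> is zero beyond \<open>N\<close>, whereas
  \<open>pullback\<close> substitutes \<open>e j\<close> for every \<open>j\<close>.\<close>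

lemma eval_poly_pullback:
  assumes "p \<in> carrier (coord_poly_ring N)"
  shows "eval_poly v (pullback p) = eval_poly (veronese_vec N e v) p"
proof -
  have "eval_poly v (pullback p) =
      (\<Sum>m\<in>Poly_Mapping.keys p. Poly_Mapping.lookup p m * eval_mon (\<lambda>j. eval_mon v (e j)) m)"
    by (simp add: pullback_def subst_poly_def eval_poly_hom)
  also have "\<dots> = eval_poly (veronese_vec N e v) p"
    using assms unfolding eval_poly_def
    by (intro sum.cong refl arg_cong2[where f = "(*)"] eval_mon_cong) (auto simp: veronese_vec_def)
  finally show ?thesis .
qed

lemma pullback_constants: "pullback ` constants = constants"
  by (force simp: constants_def pullback_single)

text \<open>A monomial of degree \<open>d * t\<close> factors into \<open>t\<close> monomials of
  degree \<open>d\<close>, each of which is the pullback of a single variable.\<close>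

lemma ex_pullback_monomial:
  assumes "m \<in> monomials n (d * t)"
  shows "\<exists>m'\<in>monomials N t. pullback (Poly_Mapping.single m' 1) =
    (Poly_Mapping.single m 1 :: 'k::field mpoly)"
  using assms
proof (induction t arbitrary: m)
  case 0
  then have "m = 0" by (auto simp: monomials_def mon_degree_def in_keys_iff intro!: poly_mapping_eqI)
  then show ?case by (intro bexI[OF _ zero_in_monomials]) (simp add: pullback_one)
next
  case (Suc t)
  then have "m \<in> monomials n (d + d * t)" by simp
  then obtain a b where ab: "a \<in> monomials n d" "b \<in> monomials n (d * t)" "m = a + b"
    by (rule monomials_addE)
  from Suc.IH[OF ab(2)] obtain b' where b': "b' \<in> monomials N t"
    "pullback (Poly_Mapping.single b' 1) = (Poly_Mapping.single b 1 :: 'k mpoly)" by blast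
  from ab(1) obtain j where j: "j \<le> N" "e j = a" by (rule e_surj)
  show ?case
  proof
    show "Poly_Mapping.single j 1 + b' \<in> monomials N (Suc t)"
      using add_in_monomials[OF single_in_monomials[OF j(1), of 1] b'(1)] by simp
    have "pullback (Poly_Mapping.single (Poly_Mapping.single j 1 + b') 1) =
        pullback (Poly_Mapping.single (Poly_Mapping.single j 1) 1) *
        (pullback (Poly_Mapping.single b' 1) :: 'k mpoly)"
      by (simp add: mult_single pullback_mult[symmetric])
    also have "\<dots> = Poly_Mapping.single m 1"
      unfolding pullback_single_var b'(2) by (simp add: mult_single j(2) ab(3))
    finally show "pullback (Poly_Mapping.single (Poly_Mapping.single j 1 + b') 1) =
        (Poly_Mapping.single m 1 :: 'k mpoly)" .
  qed
qed

text \<open>Degrees are multiplied by \<open>d\<close> in one direction. In the other, a preimage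
  \<open>r m\<close> is chosen for every monomial and extended linearly with the coefficients of
  \<open>p\<close>.\<close>

lemma pullback_image_forms: "pullback ` forms N t = (forms n (d * t) :: 'k::field mpoly set)"
proof
  show "pullback ` forms N t \<subseteq> (forms n (d * t) :: 'k mpoly set)" using pullback_in_forms by blast
  show "(forms n (d * t) :: 'k mpoly set) \<subseteq> pullback ` forms N t"
  proof
    fix p :: "'k mpoly" assume p: "p \<in> forms n (d * t)"
    have "\<forall>m\<in>monomials n (d * t). \<exists>m'. m' \<in> monomials N t \<and>
        pullback (Poly_Mapping.single m' 1) = (Poly_Mapping.single m 1 :: 'k mpoly)"
      using ex_pullback_monomial by blast
    from bchoice[OF this] obtain r where r: "r m \<in> monomials N t"
      "pullback (Poly_Mapping.single (r m) 1) = (Poly_Mapping.single m 1 :: 'k mpoly)"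
      if "m \<in> monomials n (d * t)" for m
      by blast
    define q where "q = (\<Sum>m\<in>Poly_Mapping.keys p. Poly_Mapping.single (r m) (Poly_Mapping.lookup p m))"
    have "q \<in> forms N t"
      using p r unfolding q_def by (intro sum_in_forms single_in_forms) (auto simp: forms_def)
    moreover have "pullback (Poly_Mapping.single (r m) (Poly_Mapping.lookup p m)) =
        Poly_Mapping.single m (Poly_Mapping.lookup p m)" if "m \<in> Poly_Mapping.keys p" for m
    proof -
      have "m \<in> monomials n (d * t)" using p that by (auto simp: forms_def)
      from r(2)[OF this] show ?thesis by (simp add: pullback_single mult_single)
    qed
    then have "pullback q = p"
      by (simp add: q_def pullback_sum single_sum_poly)
    ultimately show "p \<in> pullback ` forms N t" by blast
  qed
qed

section \<open>The Veronese map on points\<close>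

lemma veronese_vec_scaled:
  "veronese_vec N e (\<lambda>i. c * v i) = (\<lambda>j. c ^ d * veronese_vec N e v j)"
  using e_in_monomials by (auto simp: veronese_vec_def eval_mon_mult eval_mon_const monomials_def)

text \<open>If \<open>v i\<close> is nonzero, so is the coordinate labelled by the pure power
  \<open>x_i^d\<close>.\<close>

lemma veronese_vec_nonzero:
  assumes "v \<in> nonzero_vectors n"
  shows "veronese_vec N e v \<in> nonzero_vectors N"
proof -
  from assms obtain i where i: "i \<le> n" "v i \<noteq> 0" by (auto simp: nonzero_vectors_def)
  obtain j where "j \<le> N" "e j = Poly_Mapping.single i d"
    using single_in_monomials[OF i(1)] by (rule e_surj)
  with i show ?thesis by (auto simp: nonzero_vectors_def veronese_vec_def intro!: exI[of _ j])
qed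

text \<open>Rescaling a representative by \<open>c\<close> rescales its image by
  \<open>c ^ d\<close>, so all representatives give the same class and one of them suffices.\<close>

lemma veronese_map_eq_class:
  assumes "P \<in> proj_space n" "v \<in> P"
  shows "veronese_map N e P = proportional N `` {veronese_vec N e v}"
proof -
  have rel: "(veronese_vec N e v, veronese_vec N e u) \<in> proportional N" if u: "u \<in> P" for u
  proof -
    from u assms obtain c where "c \<noteq> 0" "u = (\<lambda>i. c * v i)"
      using proj_spaceD(2)[OF assms] by (auto simp: proportional_def)
    then show ?thesis
      using proportional_scaled[OF veronese_vec_nonzero[OF proj_spaceD(1)[OF assms]], of "c ^ d"]
      by (simp add: veronese_vec_scaled)
  qed
  have cls: "proportional N `` {veronese_vec N e u} = proportional N `` {veronese_vec N e v}"
    if "u \<in> P" for u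
    using equiv_class_eq[OF equiv_proportional rel[OF that]] by simp
  have "veronese_map N e P = (\<Union>u\<in>P. proportional N `` {veronese_vec N e u})"
    unfolding veronese_map_def by blast
  also have "\<dots> = (\<Union>u\<in>P. proportional N `` {veronese_vec N e v})"
    by (intro SUP_cong refl cls)
  also have "\<dots> = proportional N `` {veronese_vec N e v}"
    using assms(2) by blast
  finally show ?thesis .
qed

lemma veronese_map_in_proj_space:
  assumes "P \<in> proj_space n"
  shows "veronese_map N e P \<in> proj_space N"
proof -
  obtain v where v: "v \<in> P" using proj_space_nonempty[OF assms] by blast
  show ?thesis
    unfolding veronese_map_eq_class[OF assms v]
    by (intro proj_space_class(1) veronese_vec_nonzero proj_spaceD(1)[OF assms v])
qed

text \<open>Every scalar has a \<open>d\<close>-th root, so every representative of the image point is itself the image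
  of a representative.\<close>

lemma veronese_map_eq_image:
  fixes P :: "(nat \<Rightarrow> 'k::alg_closed_field) set"
  assumes "P \<in> proj_space n"
  shows "veronese_map N e P = veronese_vec N e ` P"
proof
  obtain v where v: "v \<in> P" using proj_space_nonempty[OF assms] by blast
  show "veronese_map N e P \<subseteq> veronese_vec N e ` P"
  proof
    fix w assume "w \<in> veronese_map N e P"
    then obtain c where c: "c \<noteq> 0" "w = (\<lambda>j. c * veronese_vec N e v j)"
      unfolding veronese_map_eq_class[OF assms v] by (auto simp: proportional_def)
    obtain a where a: "a ^ d = c" using nth_root_exists[OF d_pos] by blast
    with c d_pos have "a \<noteq> 0" by auto
    with proj_space_scaled[OF assms v] have "(\<lambda>i. a * v i) \<in> P" by blast
    with a c show "w \<in> veronese_vec N e ` P" by (auto simp: veronese_vec_scaled[symmetric])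
  qed
  show "veronese_vec N e ` P \<subseteq> veronese_map N e P"
  proof
    fix w assume "w \<in> veronese_vec N e ` P"
    then obtain u where u: "u \<in> P" "w = veronese_vec N e u" by blast
    show "w \<in> veronese_map N e P"
      unfolding veronese_map_eq_class[OF assms u(1)] u(2)
      by (intro proj_space_class(2) veronese_vec_nonzero proj_spaceD(1)[OF assms u(1)])
  qed
qed

section \<open>Hilbert functions of Veronese images\<close>

text \<open>The representatives of an image point are exactly the images of representatives, and at
  these the value of \<open>p\<close> is the value of its pullback.\<close>

lemma vanishing_ideal_pullback:
  fixes Y :: "(nat \<Rightarrow> 'k::alg_closed_field) set set"
  assumes "Y \<subseteq> proj_space n" "p \<in> carrier (coord_poly_ring N)"
  shows "p \<in> vanishing_ideal N (veronese_map N e ` Y) \<longleftrightarrow> pullback p \<in> vanishing_ideal n Y"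
proof -
  have "veronese_map N e P = veronese_vec N e ` P" if "P \<in> Y" for P
    using assms(1) that by (intro veronese_map_eq_image) blast
  then have "p \<in> vanishing_ideal N (veronese_map N e ` Y) \<longleftrightarrow>
      (\<forall>P\<in>Y. \<forall>v\<in>P. eval_poly (veronese_vec N e v) p = 0)"
    using assms(2) by (simp add: vanishing_ideal_def del: coord_poly_ring_simps)
  then show ?thesis
    using pullback_in_carrier[OF assms(2)] eval_poly_pullback[OF assms(2)]
    by (simp add: vanishing_ideal_def del: coord_poly_ring_simps)
qed

text \<open>An instance of \<open>dim_quotients_eq\<close> for \<open>pullback\<close>, which
  preserves the constants and maps the forms of degree \<open>t\<close> onto those of degree
  \<open>d * t\<close>.\<close>

lemma hilbert_function_veronese:
  fixes Y :: "(nat \<Rightarrow> 'k::alg_closed_field) set set"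
  assumes "Y \<subseteq> proj_space n"
  shows "hilbert_function N (veronese_map N e ` Y) t = hilbert_function n Y (d * t)"
proof -
  have coset: "residue_class m W = a_r_coset (coord_poly_ring m) (vanishing_ideal m W)"
    for m and W :: "(nat \<Rightarrow> 'k) set set"
    by (rule ext) (simp add: residue_class_def)
  have single: "Poly_Mapping.single 0 a \<in> constants" for a :: 'k
    by (auto simp: constants_def)
  let ?A = "coord_poly_ring N :: 'k mpoly ring" and ?I = "vanishing_ideal N (veronese_map N e ` Y)"
  let ?B = "coord_poly_ring n :: 'k mpoly ring" and ?J = "vanishing_ideal n Y"
  have "ring.dim (?A Quot ?I) (a_r_coset ?A ?I ` constants) (a_r_coset ?A ?I ` forms N t) =
      ring.dim (?B Quot ?J) (a_r_coset ?B ?J ` pullback ` constants) (a_r_coset ?B ?J ` pullback ` forms N t)"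
  proof (rule dim_quotients_eq)
    show "ring ?A" by (rule ring_coord_poly_ring)
    show "ideal ?J ?B" by (rule ideal_vanishing_ideal)
    show "pullback \<in> ring_hom ?A ?B" by (rule ring_hom_pullback)
    show "?I \<subseteq> carrier ?A" by (auto simp: vanishing_ideal_def simp del: coord_poly_ring_simps)
    show "p \<in> ?I \<longleftrightarrow> pullback p \<in> ?J" if "p \<in> carrier ?A" for p
      using assms that by (rule vanishing_ideal_pullback)
    show "constants \<subseteq> carrier ?A" by (rule constants_subset_carrier)
    show "\<zero>\<^bsub>?A\<^esub> \<in> constants" using single[of 0] by simp
    show "\<one>\<^bsub>?A\<^esub> \<in> constants" using single[of 1] by simp
    show "forms N t \<subseteq> carrier ?A" by (rule forms_subset_carrier)
  qed
  then show ?thesis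
    by (simp only: hilbert_function_def coordinate_ring_def coset pullback_image_forms pullback_constants)
qed

section \<open>Closed subsets of the Veronese variety\<close>

text \<open>The condition \<open>rels\<close> says that \<open>w\<close> satisfies every homogeneous
  relation among the monomials of degree \<open>d\<close>. Such a \<open>w\<close> is reached up to
  a scalar, so no roots are extracted and any field is allowed.\<close>

lemma veronese_equations_imp_veronese_vec:
  fixes w :: "nat \<Rightarrow> 'k::field"
  assumes w: "w \<in> nonzero_vectors N"
    and rels: "\<And>s f g. f \<in> forms N s \<Longrightarrow> g \<in> forms N s \<Longrightarrow> pullback f = pullback g \<Longrightarrow>
      eval_poly w f = eval_poly w g"
  obtains v c where "v \<in> nonzero_vectors n" "c \<noteq> 0" "veronese_vec N e v = (\<lambda>j. c * w j)"
proof -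
  \<comment> \<open>\<open>var\<close> stands for the variables of both rings: indices up to
    \<open>N\<close> in the source of \<open>pullback\<close>, up to \<open>n\<close> in its
    target.\<close>
  define var :: "nat \<Rightarrow> 'k mpoly" where "var i = Poly_Mapping.single (Poly_Mapping.single i 1) 1" for i
  have var_forms: "var j \<in> forms m 1" if "j \<le> m" for j m
    unfolding var_def using that by (intro single_in_forms single_in_monomials)
  have pullback_var: "pullback (var j) = Poly_Mapping.single (e j) 1" for j
    unfolding var_def by (rule pullback_single_var)
  have eval_var: "eval_poly w (var j) = w j" for j
    by (simp add: var_def eval_poly_hom)
  have single_var: "Poly_Mapping.single (Poly_Mapping.single i k) 1 = var i ^ k" for i k
    unfolding var_def by (rule single_power[symmetric])
  have single_eval: "Poly_Mapping.single m 1 = eval_mon var m" for m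
    unfolding var_def[abs_def] by (rule single_eq_eval_mon)
  have "\<exists>j. j \<le> N \<and> e j = m" if "m \<in> monomials n d" for m
    using e_surj[OF that] by blast
  then obtain r where r: "\<And>m. m \<in> monomials n d \<Longrightarrow> r m \<le> N" "\<And>m. m \<in> monomials n d \<Longrightarrow> e (r m) = m"
    by metis
  \<comment> \<open>\<open>pow i\<close> is the coordinate labelled by \<open>x_i^d\<close>.\<close>
  define pow where "pow i = r (Poly_Mapping.single i d)" for i
  have pow: "pow i \<le> N" "e (pow i) = Poly_Mapping.single i d" if "i \<le> n" for i
    unfolding pow_def using r single_in_monomials[OF that] by auto

  \<comment> \<open>With coordinates indexed by monomials, the relation
    \<open>w\<^sub>m\<^sup>d = \<Prod>i. w(x\<^sub>i\<^sup>d)\<^bsup>m(i)\<^esup>\<close> makes some coordinate \<open>w(x\<^sub>i\<^sup>d)\<close> nonzero.\<close>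
  obtain i where i: "i \<le> n" "w (pow i) \<noteq> 0"
  proof -
    from w obtain j where j: "j \<le> N" "w j \<noteq> 0" by (auto simp: nonzero_vectors_def)
    define m where "m = e j"
    have m: "Poly_Mapping.keys m \<subseteq> {..n}" "mon_degree m = d"
      using e_in_monomials[OF j(1)] by (auto simp: m_def monomials_def)
    then obtain i where i: "i \<in> Poly_Mapping.keys m" using d_pos by (fastforce simp: mon_degree_def)
    have "eval_poly w (var j ^ d) = eval_poly w (eval_mon (\<lambda>i. var (pow i)) m)"
    proof (rule rels)
      show "var j ^ d \<in> forms N d"
        using power_in_forms[OF var_forms[OF j(1)], of d] by simp
      show "eval_mon (\<lambda>i. var (pow i)) m \<in> forms N d"
        using eval_mon_in_forms[of m "\<lambda>i. var (pow i)" N 1] var_forms[OF pow(1)] m by auto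
      have "pullback (eval_mon (\<lambda>i. var (pow i)) m) = eval_mon (\<lambda>i. var i ^ d) m"
        unfolding pullback_eval_mon using m(1)
        by (intro eval_mon_cong) (auto simp: pullback_var pow single_var)
      then show "pullback (var j ^ d) = pullback (eval_mon (\<lambda>i. var (pow i)) m)"
        by (simp add: pullback_power pullback_var m_def[symmetric] eval_mon_power single_eval)
    qed
    then have "w j ^ d = eval_mon (\<lambda>i. w (pow i)) m"
      by (simp add: eval_poly_hom eval_var)
    moreover have "eval_mon (\<lambda>i. w (pow i)) m = 0" if "w (pow i) = 0"
      unfolding eval_mon_def using i that by (intro prod_zero bexI[of _ i]) (auto simp: in_keys_iff)
    ultimately have "w (pow i) \<noteq> 0" using j(2) by auto
    with i m(1) show thesis by (intro that) auto
  qed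

  \<comment> \<open>The preimage is \<open>v\<^sub>j = w(x\<^sub>i\<^bsup>d-1\<^esup> x\<^sub>j)\<close>, and the relation
    \<open>\<Prod>j. w(x\<^sub>i\<^bsup>d-1\<^esup> x\<^sub>j)\<^bsup>m(j)\<^esup> = w(x\<^sub>i\<^sup>d)\<^bsup>d-1\<^esup> w\<^sub>m\<close> identifies its image.\<close>
  define c where "c = w (pow i)"
  define q where "q j = r (Poly_Mapping.single i (d - 1) + Poly_Mapping.single j 1)" for j
  have q: "q j \<le> N" "e (q j) = Poly_Mapping.single i (d - 1) + Poly_Mapping.single j 1" if "j \<le> n" for j
  proof -
    have "Poly_Mapping.single i (d - 1) + Poly_Mapping.single j 1 \<in> monomials n d"
      using add_in_monomials[OF single_in_monomials[OF i(1)] single_in_monomials[OF that], of "d - 1" 1]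
        d_pos by simp
    then show "q j \<le> N" "e (q j) = Poly_Mapping.single i (d - 1) + Poly_Mapping.single j 1"
      unfolding q_def using r by auto
  qed
  define v where "v j = (if j \<le> n then w (q j) else 0)" for j
  \<comment> \<open>For \<open>j = i\<close> the label \<open>x_i^(d-1) x_j\<close> is
    \<open>x_i^d\<close>, so \<open>v i\<close> is the nonzero value \<open>c\<close>.\<close>
  have "q i = pow i"
    unfolding q_def pow_def using d_pos by (simp add: single_add[symmetric])
  then have "v i \<noteq> 0" using i by (simp add: v_def)
  then have "v \<in> nonzero_vectors n" using i(1) by (auto simp: nonzero_vectors_def v_def)
  moreover have "c ^ (d - 1) \<noteq> 0" using i(2) by (simp add: c_def)
  moreover have "veronese_vec N e v = (\<lambda>j. c ^ (d - 1) * w j)"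
  proof
    fix j
    show "veronese_vec N e v j = c ^ (d - 1) * w j"
    proof (cases "j \<le> N")
      case True
      define m where "m = e j"
      have m: "Poly_Mapping.keys m \<subseteq> {..n}" "mon_degree m = d"
        using e_in_monomials[OF True] by (auto simp: m_def monomials_def)
      have "eval_poly w (eval_mon (\<lambda>k. var (q k)) m) = eval_poly w (var (pow i) ^ (d - 1) * var j)"
      proof (rule rels)
        show "eval_mon (\<lambda>k. var (q k)) m \<in> forms N d"
          using eval_mon_in_forms[of m "\<lambda>k. var (q k)" N 1] var_forms[OF q(1)] m by auto
        show "var (pow i) ^ (d - 1) * var j \<in> forms N d"
          using mult_in_forms[OF power_in_forms[OF var_forms[OF pow(1)[OF i(1)]], of "d - 1"]
              var_forms[OF True]] d_pos by simp
        have "pullback (eval_mon (\<lambda>k. var (q k)) m) = eval_mon (\<lambda>k. var i ^ (d - 1) * var k) m"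
          unfolding pullback_eval_mon
        proof (rule eval_mon_cong)
          fix k assume "k \<in> Poly_Mapping.keys m"
          then have "k \<le> n" using m(1) by auto
          then show "pullback (var (q k)) = var i ^ (d - 1) * var k"
            using mult_single[of "Poly_Mapping.single i (d - 1)" 1 "Poly_Mapping.single k 1" "1::'k"]
            by (simp add: pullback_var q single_var)
        qed
        \<comment> \<open>Since \<open>m\<close> has degree \<open>d\<close>, the factor
          \<open>x_i^(d-1)\<close> occurs \<open>d\<close> times on the left, which gives the same
          power of \<open>x_i\<close> as \<open>(x_i^d)^(d-1)\<close> on the right.\<close>
        then show "pullback (eval_mon (\<lambda>k. var (q k)) m) = pullback (var (pow i) ^ (d - 1) * var j)"
          by (simp add: eval_mon_mult eval_mon_const m(2) pullback_mult pullback_power pullback_var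
              pow(2)[OF i(1)] single_var m_def[symmetric] single_eval power_mult[symmetric] mult.commute)
      qed
      then have "eval_mon (\<lambda>k. w (q k)) m = c ^ (d - 1) * w j"
        by (simp add: eval_poly_hom eval_var c_def)
      moreover have "eval_mon v m = eval_mon (\<lambda>k. w (q k)) m"
        using m(1) by (intro eval_mon_cong) (auto simp: v_def)
      ultimately show ?thesis using True by (simp add: veronese_vec_def m_def)
    next
      case False
      \<comment> \<open>Beyond \<open>N\<close> both sides are zero: \<open>veronese_vec\<close> by
        definition, \<open>w\<close> as a member of \<open>nonzero_vectors N\<close>.\<close>
      then show ?thesis using w by (simp add: veronese_vec_def nonzero_vectors_def)
    qed
  qed
  ultimately show thesis by (rule that)
qed

text \<open>The defining forms of \<open>W\<close> pull back to forms, and these vanish at a point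
  iff the original ones vanish at its image.\<close>

lemma projective_variety_preimage:
  fixes W :: "(nat \<Rightarrow> 'k::alg_closed_field) set set"
  assumes "projective_variety N W"
  shows "projective_variety n {P \<in> proj_space n. veronese_map N e P \<in> W}"
proof -
  from assms obtain F where F: "\<And>f. f \<in> F \<Longrightarrow> \<exists>t. f \<in> forms N t" "W = zero_locus N F"
    unfolding projective_variety_def by blast
  have "\<exists>t. g \<in> forms n t" if "g \<in> pullback ` F" for g
    using that F(1) pullback_in_forms by blast
  moreover have "{P \<in> proj_space n. veronese_map N e P \<in> W} = zero_locus n (pullback ` F)"
  proof -
    have "f \<in> carrier (coord_poly_ring N)" if "f \<in> F" for f
      using F(1)[OF that] forms_subset_carrier by blast
    then show ?thesis
      using veronese_map_in_proj_space unfolding F(2)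
      by (auto simp: zero_locus_def eval_poly_pullback veronese_map_eq_image simp del: coord_poly_ring_simps)
  qed
  ultimately show ?thesis unfolding projective_variety_def by blast
qed

lemma projective_variety_veronese_image:
  fixes Y :: "(nat \<Rightarrow> 'k::alg_closed_field) set set"
  assumes "projective_variety n Y"
  shows "projective_variety N (veronese_map N e ` Y)"
proof -
  from assms obtain F where F: "\<And>f. f \<in> F \<Longrightarrow> \<exists>t. f \<in> forms n t" "Y = zero_locus n F"
    unfolding projective_variety_def by blast
  have Y: "Y \<subseteq> proj_space n" by (auto simp: F(2) zero_locus_def)
  \<comment> \<open>These are the forms vanishing on the image of \<open>Y\<close>. They include
    every form with zero pullback, which forces a common zero onto the Veronese variety.\<close>
  define G where "G = {g. (\<exists>t. g \<in> forms N t) \<and> pullback g \<in> vanishing_ideal n Y}"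
  have G_carrier: "g \<in> carrier (coord_poly_ring N)" if "g \<in> G" for g
    using that forms_subset_carrier unfolding G_def by blast
  have "veronese_map N e ` Y = zero_locus N G"
  proof
    have "g \<in> vanishing_ideal N (veronese_map N e ` Y)" if "g \<in> G" for g
      using vanishing_ideal_pullback[OF Y G_carrier[OF that]] that by (simp add: G_def)
    then show "veronese_map N e ` Y \<subseteq> zero_locus N G"
      using subsetD[OF Y] by (auto simp: zero_locus_def vanishing_ideal_def veronese_map_in_proj_space)
    show "zero_locus N G \<subseteq> veronese_map N e ` Y"
    proof
      fix Q assume "Q \<in> zero_locus N G"
      then have Q: "Q \<in> proj_space N" "\<And>g w. g \<in> G \<Longrightarrow> w \<in> Q \<Longrightarrow> eval_poly w g = 0"
        by (auto simp: zero_locus_def)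
      obtain w where w: "w \<in> Q" using proj_space_nonempty[OF Q(1)] by blast
      obtain v c where v: "v \<in> nonzero_vectors n" "c \<noteq> 0" "veronese_vec N e v = (\<lambda>j. c * w j)"
      proof (rule veronese_equations_imp_veronese_vec[OF proj_spaceD(1)[OF Q(1) w]])
        fix s f g
        assume fg: "f \<in> forms N s" "g \<in> forms N s" "pullback f = (pullback g :: 'k mpoly)"
        \<comment> \<open>The pullback of the difference is zero, hence vanishes on
          \<open>Y\<close>.\<close>
        then have "f - g \<in> G"
          using diff_in_forms[of f N s g]
          by (auto simp: G_def pullback_diff vanishing_ideal_def eval_poly_hom)
        from Q(2)[OF this w] show "eval_poly w f = eval_poly w g" by (simp add: eval_poly_hom)
      qed
      define P where "P = proportional n `` {v}"
      have P: "P \<in> proj_space n" "v \<in> P" unfolding P_def using proj_space_class[OF v(1)] by auto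
      \<comment> \<open>A nonzero multiple of \<open>w\<close> represents the same point, so
        \<open>Q\<close> is the image of \<open>P\<close>.\<close>
      have "veronese_vec N e v \<in> Q" unfolding v(3) by (rule proj_space_scaled[OF Q(1) w v(2)])
      then have Q_eq: "Q = veronese_map N e P"
        using proj_spaceD(2)[OF Q(1)] veronese_map_eq_class[OF P] by simp
      have "eval_poly u f = 0" if f: "f \<in> F" and u: "u \<in> P" for f u
      proof -
        obtain s where s: "f \<in> forms n s" using F(1)[OF f] by blast
        obtain i where i: "i \<le> n" "u i \<noteq> 0"
          using proj_spaceD(1)[OF P(1) u] by (auto simp: nonzero_vectors_def)
        \<comment> \<open>The exponent raises the degree of \<open>x * f\<close> from
          \<open>s\<close> to \<open>d * s\<close>, where every form is a pullback. The index
          \<open>i\<close> was chosen with \<open>u i\<close> nonzero, so the factor can be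
          cancelled after evaluation at \<open>u\<close>.\<close>
        define x where "x = Poly_Mapping.single (Poly_Mapping.single i ((d - 1) * s)) (1::'k)"
        have "(d - 1) * s + s = d * s" using d_pos by (cases d) auto
        then have "x * f \<in> forms n (d * s)"
          using mult_in_forms[OF single_in_forms[OF single_in_monomials[OF i(1)]] s] unfolding x_def by metis
        then have "x * f \<in> pullback ` forms N s" by (simp only: pullback_image_forms)
        then obtain g where g: "g \<in> forms N s" "pullback g = x * f" by force
        have "x * f \<in> vanishing_ideal n Y"
          using f forms_subset_carrier \<open>x * f \<in> forms n (d * s)\<close>
          by (auto simp: vanishing_ideal_def F(2) zero_locus_def eval_poly_hom simp del: coord_poly_ring_simps)
        with g have "g \<in> G" by (auto simp: G_def)
        moreover have "veronese_vec N e u \<in> Q"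
          unfolding Q_eq veronese_map_eq_image[OF P(1)] using u by (rule imageI)
        ultimately have "eval_poly u (pullback g) = 0"
          using Q(2) eval_poly_pullback[OF G_carrier] by metis
        then show ?thesis using i by (simp add: g x_def eval_poly_hom)
      qed
      then have "P \<in> Y" using P by (simp add: F(2) zero_locus_def)
      then show "Q \<in> veronese_map N e ` Y" using Q_eq by blast
    qed
  qed
  moreover have "\<forall>g\<in>G. \<exists>t. g \<in> forms N t" by (simp add: G_def)
  ultimately show ?thesis unfolding projective_variety_def by blast
qed

end

section \<open>Hilbert functions of subvarieties of the Veronese variety\<close>

theorem theorem2p6:
  fixes n d N :: nat
    and h :: "nat \<Rightarrow> nat"
    and e :: "nat \<Rightarrow> nat \<Rightarrow>\<^sub>0 nat"
    and Z :: "(nat \<Rightarrow> 'k::{alg_closed_field, field_char_0}) set set"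
  assumes "n > 0" and "d > 0"
    and "N = ((n + d) choose d) - 1"
    and "bij_betw e {..N} (monomials n d)"
    and "projective_variety N Z" and "h = hilbert_function N Z"
  shows "(\<exists>W :: (nat \<Rightarrow> 'k) set set. projective_variety N W \<and> W \<subseteq> veronese_variety n N e \<and>
            (\<forall>t. hilbert_function N W t = h t))
    \<longleftrightarrow> (\<exists>k. (\<exists>Y :: (nat \<Rightarrow> 'k) set set. projective_variety n Y \<and> k = hilbert_function n Y) \<and>
            (\<forall>t. h t = k (d * t)))"
proof -
  interpret veronese n d N e using assms(2,4) by unfold_locales
  show ?thesis
  proof
    assume "\<exists>W :: (nat \<Rightarrow> 'k) set set. projective_variety N W \<and> W \<subseteq> veronese_variety n N e \<and>
      (\<forall>t. hilbert_function N W t = h t)"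
    then obtain W :: "(nat \<Rightarrow> 'k) set set" where W: "projective_variety N W"
      "W \<subseteq> veronese_map N e ` proj_space n" "\<And>t. hilbert_function N W t = h t"
      unfolding veronese_variety_def by blast
    define Y where "Y = {P \<in> proj_space n. veronese_map N e P \<in> W}"
    \<comment> \<open>As \<open>W\<close> lies in the image of the Veronese map, it is the image of
      its own preimage.\<close>
    have "veronese_map N e ` Y = W" using W(2) unfolding Y_def by blast
    moreover have "Y \<subseteq> proj_space n" unfolding Y_def by blast
    ultimately have "h t = hilbert_function n Y (d * t)" for t
      using hilbert_function_veronese[of Y t] W(3)[of t] by simp
    moreover have "projective_variety n Y" unfolding Y_def by (rule projective_variety_preimage[OF W(1)])
    ultimately show "\<exists>k. (\<exists>Y :: (nat \<Rightarrow> 'k) set set. projective_variety n Y \<and> k = hilbert_function n Y) \<and>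
      (\<forall>t. h t = k (d * t))" by blast
  next
    assume "\<exists>k. (\<exists>Y :: (nat \<Rightarrow> 'k) set set. projective_variety n Y \<and> k = hilbert_function n Y) \<and>
      (\<forall>t. h t = k (d * t))"
    then obtain Y :: "(nat \<Rightarrow> 'k) set set" where Y: "projective_variety n Y"
      "\<And>t. h t = hilbert_function n Y (d * t)" by blast
    from Y(1) have "Y \<subseteq> proj_space n" by (auto simp: projective_variety_def zero_locus_def)
    then show "\<exists>W :: (nat \<Rightarrow> 'k) set set. projective_variety N W \<and> W \<subseteq> veronese_variety n N e \<and>
      (\<forall>t. hilbert_function N W t = h t)"
      using projective_variety_veronese_image[OF Y(1)] hilbert_function_veronese[of Y] Y(2)
      unfolding veronese_variety_def
      by (intro exI[of _ "veronese_map N e ` Y"]) auto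
  qed
qed

end
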